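(* Let $k\ge 0$ and suppose that - the system has additive noise, i.e. it is $\dot x(t)=f(x(t))+v(t)$ with $v(t)=(v_1(t),\dots,v_n(t))$ vector-valued, - $f$ is a $C^2$ function, and - for all $i=1,\dots,n$, $w_i$ is a real-valued (measurable) function on $[t_k,t_{k+1}]$ with $|w_i(t)|\le rV_i$ for some constant $r\in\mathbb{R}$, satisfying $$\int_{t_k}^{t_{k+1}}\bigl(v_i(t)-w_i(t)\bigr)\,dt=0,\qquad \int_{t_k}^{t_{k+1}}(t-t_{k+1/2})\bigl(v_i(t)-w_i(t)\bigr)\,dt=0.$$ Let $x$ and $y$ be solutions on $[t_k,t_{k+1}]$ of $\dot x=f(x)+v(t)$ and of $\dot y=f(y)+w(t)$, $w=(w_1,\dots,w_n)$, respectively, with $x(t_k)=y(t_k)$. Then the local error $\|x(t_{k+1})-y(t_{k+1})\|$ is $O(h^3)$: $$\begin{aligned} \bigl(1-(h_k/2)L\bigr)\,\|x(t_{k+1})-y(t_{k+1})\|\le{}&\frac{h_k^3}{8}(1+r)\,K'H\,(K+K')\\ &+\frac{h_k^3}{4}(1+r)\,K'\Bigl(L^2+H\,(K+rK')\Bigr)\varphi(\Lambda h_k). \end{aligned}$$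
   Context: Setting. $f:\mathbb{R}^n\to\mathbb{R}^n$; each $v_i$ ($i=1,\dots,n$) is an arbitrary measurable function with $v_i(t)\in[-V_i,V_i]$, $V_i>0$. This is the special case of the input-affine system $\dot x=f(x)+\sum_i g_i(x)v_i(t)$ in which $m=n$ and $g_i$ is the constant $i$-th unit vector. Solutions are absolutely continuous functions satisfying the equation for almost every $t$. The interval $[0,T]$ is partitioned as $0=t_0<t_1<\dots<t_N=T$, $h_k=t_{k+1}-t_k$ and $t_{k+1/2}=t_k+h_k/2$. Norms. $\|\cdot\|$ is the supremum norm on $\mathbb{R}^n$ and the induced norms on matrices and on bilinear maps (for the second derivative $D^2f$). The logarithmic norm of a square matrix $Q$ is $\lambda(Q)=\lim_{h\to0^+}(\|I+hQ\|-1)/h$, i.e. $\lambda(Q)=\max_k\{q_{kk}+\sum_{i\ne k}|q_{ki}|\}$. Bounds. $B\subset\mathbb{R}^n$ is a box containing the values on $[0,T]$ of all solutions under consideration of both systems (for all admissible inputs, including zero inputs). The constants satisfy, for all $z\in B$: $\|f(z)\|\le K$, $\lambda(Df(z))\le\Lambda$, $\|Df(z)\|\le L$, $\|D^2f(z)\|\le H$. Put $K'=\sum_{i=1}^n V_iK_i$ with $K_i\geq 1$ a bound on the norm of the $i$-th unit vector (so one may take $K_i=1$, $K'=\sum_i V_i$), and $\varphi(s)=(e^s-1)/s$, with $\varphi(0)=1$. "Local error is $O(h^3)$" means bounded by $C h_k^3$ for all sufficiently small $h_k$, with $C$ depending only on $T$ and the constants above, not on $k$ or on the particular inputs. *)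

theory Defs
  imports "HOL-Analysis.Analysis"
begin

text \<open>
  The norm on \<^typ>\<open>real^'n\<close> used throughout is the supremum norm \<^const>\<open>infnorm\<close>; the
  library's \<^const>\<open>norm\<close> on this type is Euclidean, so \<^const>\<open>onorm\<close> is not the operator
  norm needed here. The suprema below are bounded because the maps are (bi)linear in finite
  dimension; the quotients with zero denominator have value 0 and do not affect them.
\<close>

definition mat_infnorm :: "real^'n^'n \<Rightarrow> real" where
  "mat_infnorm A = (SUP x. infnorm (A *v x) / infnorm x)"

definition bilin_infnorm :: "(real^'n \<Rightarrow> real^'n \<Rightarrow> real^'n) \<Rightarrow> real" where
  "bilin_infnorm b = (SUP (x, y). infnorm (b x y) / (infnorm x * infnorm y))"

definition log_infnorm :: "real^'n^'n \<Rightarrow> real" where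
  "log_infnorm Q = Lim (at_right 0) (\<lambda>h. (mat_infnorm (mat 1 + h *\<^sub>R Q) - 1) / h)"

definition second_derivative :: "(real^'n \<Rightarrow> real^'n) \<Rightarrow> real^'n \<Rightarrow> real^'n \<Rightarrow> real^'n \<Rightarrow> real^'n" where
  "second_derivative f z u v = frechet_derivative (\<lambda>p. jacobian f (at p)) (at z) u *v v"

text \<open>In finite dimension, continuity of the second derivative as a map into the bilinear maps
  is the same as its pointwise continuity, which is how it is expressed here.\<close>

definition C2_function :: "(real^'n \<Rightarrow> real^'n) \<Rightarrow> bool" where
  "C2_function f \<longleftrightarrow>
     (\<forall>z. f differentiable at z) \<and>
     (\<forall>z. (\<lambda>p. jacobian f (at p)) differentiable at z) \<and>
     (\<forall>u v. continuous_on UNIV (\<lambda>z. second_derivative f z u v))"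

text \<open>A \<open>division_of\<close> is a finite family of compact intervals with disjoint interiors, so this
  is the usual \<open>\<epsilon>\<close>-\<open>\<delta>\<close> definition, with \<open>{Inf J..Sup J} = J\<close> ranging over the family.
  It is unrelated to the library's \<^const>\<open>absolutely_continuous\<close>, which concerns measures.\<close>

definition abs_continuous_on :: "real set \<Rightarrow> (real \<Rightarrow> 'a::real_normed_vector) \<Rightarrow> bool" where
  "abs_continuous_on I x \<longleftrightarrow>
     (\<forall>\<epsilon>>0. \<exists>\<delta>>0. \<forall>D S. D division_of S \<and> S \<subseteq> I \<and> (\<Sum>J\<in>D. Sup J - Inf J) < \<delta> \<longrightarrow>
        (\<Sum>J\<in>D. norm (x (Sup J) - x (Inf J))) < \<epsilon>)"

definition solution_on ::
    "real set \<Rightarrow> (real^'n \<Rightarrow> real^'n) \<Rightarrow> (real \<Rightarrow> real^'n) \<Rightarrow> (real \<Rightarrow> real^'n) \<Rightarrow> bool" where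
  "solution_on I f v x \<longleftrightarrow>
     abs_continuous_on I x \<and>
     (AE s in lebesgue. s \<in> I \<longrightarrow> (x has_vector_derivative f (x s) + v s) (at s within I))"

definition bounded_input_on :: "real set \<Rightarrow> ('n \<Rightarrow> real) \<Rightarrow> (real \<Rightarrow> real^'n) \<Rightarrow> bool" where
  "bounded_input_on I V v \<longleftrightarrow>
     (\<forall>i. (\<lambda>s. v s $ i) \<in> borel_measurable (lebesgue_on I) \<and> (\<forall>s\<in>I. \<bar>v s $ i\<bar> \<le> V i))"

definition time_partition :: "real \<Rightarrow> nat \<Rightarrow> (nat \<Rightarrow> real) \<Rightarrow> bool" where
  "time_partition T N t \<longleftrightarrow> t 0 = 0 \<and> t N = T \<and> (\<forall>j<N. t j < t (Suc j))"

definition phi :: "real \<Rightarrow> real" where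
  "phi s = (if s = 0 then 1 else (exp s - 1) / s)"

end

theory Submission
  imports Defs
begin

text \<open>
  Write \<open>J\<close> for the derivative of \<open>f\<close>, \<open>h\<close> for the length and \<open>m\<close> for the midpoint of the step, and
  \<open>e(s) = x(s) - y(s)\<close>. Because \<open>v\<close> and \<open>w\<close> have the same mean, \<open>e\<close> at the end of the step is the
  integral of \<open>f(x) - f(y)\<close>. Integrating by parts with the centred weight \<open>s - m\<close> turns it into
  \<open>(h/2) (f(x) - f(y))\<close> at the end of the step, of norm at most \<open>(h/2) L \<parallel>e\<parallel>\<close> there, minus the
  integral of \<open>(s - m) (J(x) (f(x) + v) - J(y) (f(y) + w))\<close> (lemma \<open>moment_integral\<close>). The bracket
  is the sum of

  \<^item> \<open>J(x(m)) (v - w)\<close>, which drops out because the first moments of \<open>v\<close> and \<open>w\<close> agree;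
  \<^item> \<open>(J(x(s)) - J(x(m))) (v - w)\<close>, at most \<open>H (K + K') (h/2) (1 + r) K'\<close>, since \<open>x\<close> has speed at
    most \<open>K + K'\<close>;
  \<^item> the difference of \<open>z \<mapsto> J(z) (f(z) + w)\<close> at \<open>x(s)\<close> and \<open>y(s)\<close>, at most
    \<open>(L\<^sup>2 + H (K + r K')) \<parallel>e(s)\<parallel>\<close>.

  Since \<open>\<bar>s - m\<bar>\<close> has integral \<open>h\<^sup>2/4\<close>, the last two items give the two terms of the bound, once
  \<open>\<parallel>e(s)\<parallel> \<le> (1 + r) K' h \<phi>(\<Lambda> h)\<close> is known (lemma \<open>difference_bound\<close>).

  That bound is a Gronwall estimate with the logarithmic norm as rate. The norm of \<open>e\<close> need not be
  differentiable, so it is derived from Euler steps: \<open>z \<mapsto> z + \<eta> f(z)\<close> expands distances by at most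
  \<open>1 + \<Lambda> \<eta>\<close> for all sufficiently small \<open>\<eta>\<close>, uniformly on the box, because for the supremum norm
  \<open>\<parallel>I + \<eta> J\<parallel>\<close> is affine in \<open>\<eta>\<close> while \<open>\<eta> \<parallel>J\<parallel> \<le> 1\<close> (lemma \<open>mat_infnorm_perturbation\<close>). Each short time
  step of \<open>e\<close> is such an Euler step up to an input term and a quadratic error, and the
  subdivision limit (lemma \<open>one_step_bound_imp_growth_bound\<close>) produces \<open>\<phi>\<close>.

  Solutions are only absolutely continuous. All integral identities come from the fundamental
  theorem of calculus for such functions, which is proved with gauge integrals: the intervals
  tagged in the null set where the derivative fails carry little variation.
\<close>

section \<open>Absolutely continuous functions and their derivatives\<close>

lemma abs_continuous_on_subset:
  assumes "abs_continuous_on I F" "J \<subseteq> I"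
  shows "abs_continuous_on J F"
  unfolding abs_continuous_on_def
proof (intro allI impI)
  fix \<epsilon> :: real assume "\<epsilon> > 0"
  then obtain \<delta> where "\<delta> > 0" and
    *: "\<And>D S. D division_of S \<Longrightarrow> S \<subseteq> I \<Longrightarrow> (\<Sum>J\<in>D. Sup J - Inf J) < \<delta> \<Longrightarrow>
          (\<Sum>J\<in>D. norm (F (Sup J) - F (Inf J))) < \<epsilon>"
    using assms(1) unfolding abs_continuous_on_def by meson
  then show "\<exists>\<delta>>0. \<forall>D S. D division_of S \<and> S \<subseteq> J \<and> (\<Sum>J\<in>D. Sup J - Inf J) < \<delta> \<longrightarrow>
        (\<Sum>J\<in>D. norm (F (Sup J) - F (Inf J))) < \<epsilon>"
    using assms(2) by (intro exI[of _ \<delta>]) (auto intro: *)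
qed

lemma division_of_interval:
  assumes "D division_of S" "J \<in> D"
  shows "Inf J \<le> Sup J" "J = {Inf J..Sup J}" "Inf J \<in> S" "Sup J \<in> S"
    "measure lebesgue J = Sup J - Inf (J :: real set)"
proof -
  obtain u v where J: "J = cbox u v" "J \<noteq> {}" "J \<subseteq> S"
    using division_ofD(2,3,4)[OF assms(1)] assms(2) by metis
  then have "u \<le> v" by auto
  with J show "Inf J \<le> Sup J" "J = {Inf J..Sup J}" "Inf J \<in> S" "Sup J \<in> S"
    "measure lebesgue J = Sup J - Inf J"
    by (auto simp: subset_iff)
qed

lemma lipschitz_imp_abs_continuous_on:
  assumes "C-lipschitz_on I F"
  shows "abs_continuous_on I F"
  unfolding abs_continuous_on_def
proof (intro allI impI)
  fix \<epsilon> :: real assume e: "\<epsilon> > 0"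
  have C: "C \<ge> 0" using assms lipschitz_on_nonneg by blast
  show "\<exists>\<delta>>0. \<forall>D S. D division_of S \<and> S \<subseteq> I \<and> (\<Sum>J\<in>D. Sup J - Inf J) < \<delta> \<longrightarrow>
        (\<Sum>J\<in>D. norm (F (Sup J) - F (Inf J))) < \<epsilon>"
  proof (intro exI[of _ "\<epsilon> / (C + 1)"] conjI allI impI)
    show "\<epsilon> / (C + 1) > 0" using e C by simp
    fix D S assume D: "D division_of S \<and> S \<subseteq> I \<and> (\<Sum>J\<in>D. Sup J - Inf J) < \<epsilon> / (C + 1)"
    have "(\<Sum>J\<in>D. norm (F (Sup J) - F (Inf J))) \<le> (\<Sum>J\<in>D. C * (Sup J - Inf J))"
    proof (rule sum_mono)
      fix J assume J: "J \<in> D"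
      note i = division_of_interval[of D S J]
      have "norm (F (Sup J) - F (Inf J)) \<le> C * norm (Sup J - Inf J)"
        using lipschitz_on_normD[OF assms] i D J by blast
      then show "norm (F (Sup J) - F (Inf J)) \<le> C * (Sup J - Inf J)"
        using i D J by simp
    qed
    also have "\<dots> = C * (\<Sum>J\<in>D. Sup J - Inf J)" by (simp add: sum_distrib_left)
    also have "\<dots> \<le> C * (\<epsilon> / (C + 1))" using D C by (intro mult_left_mono) auto
    also have "\<dots> < \<epsilon>" using C e by (simp add: field_simps)
    finally show "(\<Sum>J\<in>D. norm (F (Sup J) - F (Inf J))) < \<epsilon>" .
  qed
qed

text \<open>An absolutely continuous function hardly moves on a null set: once the exceptional set is
  enclosed in an open set of small measure, any family of nonoverlapping tagged intervals inside
  that open set has small total length, whence small total variation.\<close>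

lemma abs_continuous_on_small_on_negligible:
  fixes F :: "real \<Rightarrow> 'a::real_normed_vector"
  assumes ac: "abs_continuous_on {a..b} F" and N: "negligible N" and e: "\<epsilon> > 0"
  obtains U where "open U" "N \<subseteq> U"
    "\<And>q. q tagged_partial_division_of {a..b} \<Longrightarrow> \<Union>(snd ` q) \<subseteq> U \<Longrightarrow>
       (\<Sum>(s, J)\<in>q. norm (F (Sup J) - F (Inf J))) < \<epsilon>"
proof -
  obtain \<delta> where \<delta>: "\<delta> > 0" and
    ac': "\<And>D S. D division_of S \<Longrightarrow> S \<subseteq> {a..b} \<Longrightarrow> (\<Sum>J\<in>D. Sup J - Inf J) < \<delta> \<Longrightarrow>
          (\<Sum>J\<in>D. norm (F (Sup J) - F (Inf J))) < \<epsilon>"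
    using ac e unfolding abs_continuous_on_def by meson
  obtain U where U: "open U" "N \<subseteq> U" "U - N \<in> lmeasurable" "emeasure lebesgue (U - N) < ennreal \<delta>"
    using sets_lebesgue_outer_open[OF negligible_imp_sets[OF N] \<delta>] by blast
  have N0: "N \<in> null_sets lebesgue" using N negligible_iff_null_sets by blast
  have Ulm: "U \<in> lmeasurable"
    using U(3) N0 \<open>N \<subseteq> U\<close> by (metis Diff_partition Un_commute fmeasurable.Un negligible_imp_measurable N)
  have "measure lebesgue U = measure lebesgue (U - N)"
    using N0 Ulm by (simp add: fmeasurableD measure_Diff_null_set)
  then have mU: "measure lebesgue U < \<delta>"
    using U(3,4) \<delta> by (simp add: emeasure_eq_measure2 ennreal_less_iff)
  show thesis
  proof (rule that[OF U(1,2)])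
    fix q assume q: "q tagged_partial_division_of {a..b}" and qU: "\<Union>(snd ` q) \<subseteq> U"
    define D where "D = snd ` q"
    have tq: "q tagged_division_of (\<Union>D)"
      unfolding D_def by (rule tagged_partial_division_of_Union_self[OF q])
    have dD: "D division_of (\<Union>D)"
      unfolding D_def using division_of_tagged_division[OF tq] by (simp add: D_def)
    \<comment> \<open>The guard matters only for the value of the summand at the empty interval,
      where it has to vanish for the sum over tagged intervals to be a sum over the intervals.\<close>
    define d where "d J = (if J = {} then 0 else norm (F (Sup J) - F (Inf J)))" for J
    have "(\<Sum>(s, J)\<in>q. norm (F (Sup J) - F (Inf J))) = (\<Sum>(s, J)\<in>q. d J)"
      using tagged_division_ofD(2)[OF tq] by (intro sum.cong) (fastforce simp: d_def)+
    also have "\<dots> = (\<Sum>J\<in>D. d J)"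
      unfolding D_def
    proof (rule sum.over_tagged_division_lemma[OF tq])
      fix u v :: real assume "box u v = {}"
      then show "d (cbox u v) = 0" by (cases "u = v") (auto simp: d_def)
    qed
    also have "\<dots> = (\<Sum>J\<in>D. norm (F (Sup J) - F (Inf J)))"
      using division_ofD(3)[OF dD] by (intro sum.cong) (auto simp: d_def)
    also have "\<dots> < \<epsilon>"
    proof (rule ac'[OF dD])
      show "\<Union>D \<subseteq> {a..b}" using q unfolding D_def tagged_partial_division_of_def by fastforce
      have "(\<Sum>J\<in>D. Sup J - Inf J) = (\<Sum>J\<in>D. measure lebesgue J)"
        using division_of_interval[OF dD] by (intro sum.cong) auto
      also have "\<dots> = measure lebesgue (\<Union>D)" by (rule content_division[OF dD])
      also have "\<dots> \<le> measure lebesgue U"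
        using qU Ulm dD unfolding D_def by (intro measure_mono_fmeasurable) (auto intro: fmeasurableD lmeasurable_division)
      finally show "(\<Sum>J\<in>D. Sup J - Inf J) < \<delta>" using mU by simp
    qed
    finally show "(\<Sum>(s, J)\<in>q. norm (F (Sup J) - F (Inf J))) < \<epsilon>" .
  qed
qed

text \<open>The Henstock sums converge for a gauge chosen by the kind of tag. At a tag where the derivative
  exists, a small interval contributes an error at most \<open>e\<close> times its length. At an
  exceptional tag the derivative is replaced by \<open>0\<close>, and the increments of \<open>F\<close> over those
  intervals are jointly small by absolute continuity.\<close>

theorem fundamental_theorem_of_calculus_abs_continuous:
  fixes F :: "real \<Rightarrow> 'a::banach"
  assumes ab: "a \<le> b" and ac: "abs_continuous_on {a..b} F" and N: "negligible N"
    and deriv: "\<And>s. s \<in> {a..b} - N \<Longrightarrow> (F has_vector_derivative g s) (at s within {a..b})"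
  shows "(g has_integral (F b - F a)) {a..b}"
proof -
  define g' where "g' s = (if s \<in> N then 0 else g s)" for s
  have "(g' has_integral (F b - F a)) {a..b}"
    unfolding has_integral_real
  proof (intro allI impI)
    fix \<epsilon> :: real assume "\<epsilon> > 0"
    define e where "e = \<epsilon> / (2 * (b - a + 1))"
    have e: "e > 0" "e * (b - a) < \<epsilon> / 2"
      using ab \<open>\<epsilon> > 0\<close> by (auto simp: e_def field_simps)
    have "\<forall>s. \<exists>d>0. s \<in> {a..b} - N \<longrightarrow>
         (\<forall>z\<in>{a..b}. norm (z - s) < d \<longrightarrow> norm (F z - F s - (z - s) *\<^sub>R g s) \<le> e * norm (z - s))"
      using deriv[unfolded has_vector_derivative_def has_derivative_within_alt] e(1) zero_less_one by blast
    then obtain d where d: "\<And>s. 0 < d s"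
      "\<And>s z. s \<in> {a..b} - N \<Longrightarrow> z \<in> {a..b} \<Longrightarrow> norm (z - s) < d s
          \<Longrightarrow> norm (F z - F s - (z - s) *\<^sub>R g s) \<le> e * norm (z - s)"
      by metis
    obtain U where U: "open U" "N \<subseteq> U"
      "\<And>q. q tagged_partial_division_of {a..b} \<Longrightarrow> \<Union>(snd ` q) \<subseteq> U \<Longrightarrow>
         (\<Sum>(s, J)\<in>q. norm (F (Sup J) - F (Inf J))) < \<epsilon> / 2"
      using abs_continuous_on_small_on_negligible[OF ac N, of "\<epsilon> / 2"] \<open>\<epsilon> > 0\<close> by auto
    define \<gamma> where "\<gamma> s = (if s \<in> N then U else ball s (d s))" for s
    show "\<exists>\<gamma>. gauge \<gamma> \<and> (\<forall>p. p tagged_division_of {a..b} \<and> \<gamma> fine p \<longrightarrow>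
        norm ((\<Sum>(s, J)\<in>p. measure lborel J *\<^sub>R g' s) - (F b - F a)) < \<epsilon>)"
    proof (intro exI[of _ \<gamma>] conjI allI impI)
      show "gauge \<gamma>" using U d(1) by (auto simp: gauge_def \<gamma>_def)
      fix p assume p: "p tagged_division_of {a..b} \<and> \<gamma> fine p"
      then have pt: "p tagged_division_of {a..b}" and fine: "\<gamma> fine p" by auto
      have fin: "finite p" using pt by blast
      define q where "q = {(s, J) \<in> p. s \<in> N}"
      have qp: "q \<subseteq> p" by (auto simp: q_def)
      have interval: "\<exists>u v. J = {u..v} \<and> u \<le> s \<and> s \<le> v \<and> a \<le> u \<and> v \<le> b" if "(s, J) \<in> p" for s J
        using tagged_division_ofD(2-4)[OF pt that] by (fastforce simp: box_real)
      have Fab: "F b - F a = (\<Sum>(s, J)\<in>p. F (Sup J) - F (Inf J))"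
        using additive_tagged_division_1[OF ab pt, of F] by simp
      have len: "b - a = (\<Sum>(s, J)\<in>p. Sup J - Inf J)"
        using additive_tagged_division_1[OF ab pt, of "\<lambda>s. s"] by simp
      have bad: "(\<Sum>(s, J)\<in>q. norm (F (Sup J) - F (Inf J))) < \<epsilon> / 2"
      proof (rule U(3))
        show "q tagged_partial_division_of {a..b}"
          using pt qp tagged_partial_division_subset unfolding tagged_division_of_def by blast
        show "\<Union>(snd ` q) \<subseteq> U"
          using fine by (fastforce simp: q_def fine_def \<gamma>_def)
      qed
      have good: "norm (measure lborel J *\<^sub>R g' s - (F (Sup J) - F (Inf J))) \<le> e * (Sup J - Inf J)"
        if sJ: "(s, J) \<in> p - q" for s J
      proof -
        have sN: "s \<notin> N" using sJ by (auto simp: q_def)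
        obtain u v where J: "J = {u..v}" "u \<le> s" "s \<le> v" "a \<le> u" "v \<le> b"
          using interval sJ by blast
        have "J \<subseteq> ball s (d s)"
          using fineD[OF fine, of s J] sJ sN by (simp add: \<gamma>_def)
        then have near: "norm (u - s) < d s" "norm (v - s) < d s"
          using J by (force simp: subset_iff dist_real_def)+
        have v: "norm (F v - F s - (v - s) *\<^sub>R g s) \<le> e * (v - s)"
          using d(2)[of s v] near J sN by auto
        have u: "norm (F u - F s - (u - s) *\<^sub>R g s) \<le> e * (s - u)"
          using d(2)[of s u] near J sN by auto
        have "measure lborel J *\<^sub>R g' s - (F (Sup J) - F (Inf J))
            = (F u - F s - (u - s) *\<^sub>R g s) - (F v - F s - (v - s) *\<^sub>R g s)"
          using J sN by (simp add: g'_def algebra_simps)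
        also have "norm \<dots> \<le> e * (s - u) + e * (v - s)"
          using u v norm_triangle_ineq4 by (meson add_mono order_trans)
        finally show ?thesis using J by (simp add: algebra_simps)
      qed
      have "norm ((\<Sum>(s, J)\<in>p. measure lborel J *\<^sub>R g' s) - (F b - F a))
          = norm (\<Sum>(s, J)\<in>p. measure lborel J *\<^sub>R g' s - (F (Sup J) - F (Inf J)))"
        unfolding Fab by (simp add: sum_subtractf case_prod_unfold)
      also have "\<dots> \<le> (\<Sum>(s, J)\<in>p. norm (measure lborel J *\<^sub>R g' s - (F (Sup J) - F (Inf J))))"
        by (rule order_trans[OF norm_sum]) (simp add: case_prod_unfold)
      also have "\<dots> = (\<Sum>(s, J)\<in>p - q. norm (measure lborel J *\<^sub>R g' s - (F (Sup J) - F (Inf J))))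
          + (\<Sum>(s, J)\<in>q. norm (measure lborel J *\<^sub>R g' s - (F (Sup J) - F (Inf J))))"
        by (rule sum.subset_diff[OF qp fin])
      also have "(\<Sum>(s, J)\<in>q. norm (measure lborel J *\<^sub>R g' s - (F (Sup J) - F (Inf J))))
          = (\<Sum>(s, J)\<in>q. norm (F (Sup J) - F (Inf J)))"
        by (rule sum.cong) (auto simp: q_def g'_def norm_minus_commute)
      also have "(\<Sum>(s, J)\<in>p - q. norm (measure lborel J *\<^sub>R g' s - (F (Sup J) - F (Inf J))))
          \<le> (\<Sum>(s, J)\<in>p - q. e * (Sup J - Inf J))"
        using good by (intro sum_mono) auto
      also have "\<dots> \<le> (\<Sum>(s, J)\<in>p. e * (Sup J - Inf J))"
        using interval e fin by (intro sum_mono2) fastforce+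
      also have "\<dots> = e * (b - a)"
        unfolding len by (simp add: sum_distrib_left case_prod_unfold)
      finally show "norm ((\<Sum>(s, J)\<in>p. measure lborel J *\<^sub>R g' s) - (F b - F a)) < \<epsilon>"
        using bad e(2) by linarith
    qed
  qed
  then show ?thesis
    by (rule has_integral_spike[OF N, rotated]) (auto simp: g'_def)
qed

section \<open>The supremum norm, its operator norms and its logarithmic norm\<close>

lemma infnorm_le_iff_cart: "infnorm (x :: real^'n) \<le> c \<longleftrightarrow> (\<forall>i. \<bar>x $ i\<bar> \<le> c)"
proof
  assume "\<forall>i. \<bar>x $ i\<bar> \<le> c"
  then show "infnorm x \<le> c"
    unfolding infnorm_cart by (intro cSup_least) auto
qed (use component_le_infnorm_cart order_trans in blast)

lemma infnorm_le_add: "z = x + y \<Longrightarrow> infnorm z \<le> infnorm x + infnorm y"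
  by (simp add: infnorm_triangle)

lemma infnorm_has_integral_le:
  fixes g :: "real \<Rightarrow> real^'n"
  assumes g: "(g has_integral I) S" and G: "(G has_integral c) S"
    and le: "\<And>s. s \<in> S \<Longrightarrow> infnorm (g s) \<le> G s"
  shows "infnorm I \<le> c"
  unfolding infnorm_le_iff_cart
proof
  fix i
  have "((\<lambda>s. g s $ i) has_integral I $ i) S"
    using has_integral_linear[OF g bounded_linear_vec_nth] by (simp add: o_def)
  moreover have "\<bar>g s $ i\<bar> \<le> G s" if "s \<in> S" for s
    using le[OF that] infnorm_le_iff_cart by blast
  ultimately have "I $ i \<le> c" "- c \<le> I $ i"
    using has_integral_le[OF _ G] has_integral_le[OF has_integral_neg[OF G]]
    by (force simp: abs_le_iff)+
  then show "\<bar>I $ i\<bar> \<le> c" by linarith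
qed

lemma infnorm_has_integral_le_const:
  fixes g :: "real \<Rightarrow> real^'n"
  assumes "(g has_integral I) {p..q}" "p \<le> q" "\<And>s. s \<in> {p..q} \<Longrightarrow> infnorm (g s) \<le> c"
  shows "infnorm I \<le> c * (q - p)"
proof -
  have "((\<lambda>s. c) has_integral c * (q - p)) {p..q}"
    using has_integral_const_real[of c p q] assms(2) by (simp add: mult.commute)
  with assms show ?thesis using infnorm_has_integral_le by blast
qed

lemma has_integral_vec_component:
  fixes g :: "real \<Rightarrow> real^'n"
  assumes "\<And>i. ((\<lambda>s. g s $ i) has_integral I $ i) S"
  shows "(g has_integral I) S"
proof (rule has_integral_componentwise)
  fix e :: "real^'n" assume "e \<in> Basis"
  then obtain i where "e = axis i 1" by (auto simp: Basis_vec_def)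
  then show "((\<lambda>s. g s \<bullet> e) has_integral I \<bullet> e) S"
    using assms[of i] by (simp add: inner_axis)
qed

lemma norm_le_sqrt_infnorm: "norm (x :: real^'n) \<le> sqrt (real CARD('n)) * infnorm x"
  using norm_le_infnorm[of x] by simp

text \<open>A supremum in the reals bounds its members only if the set is bounded; the bound comes from
  boundedness of bilinear maps in the Euclidean norm and equivalence of the two norms.\<close>

lemma infnorm_le_bilin_infnorm:
  fixes b :: "real^'n \<Rightarrow> real^'n \<Rightarrow> real^'n"
  assumes "bilinear b"
  shows "infnorm (b x y) \<le> bilin_infnorm b * infnorm x * infnorm y"
proof (cases "x = 0 \<or> y = 0")
  case True
  then show ?thesis using assms by (auto simp: bilinear_lzero bilinear_rzero infnorm_0)
next
  case False
  obtain C where C: "\<And>x y. norm (b x y) \<le> C * norm x * norm y"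
    using bilinear_bounded[OF assms] by blast
  let ?s = "sqrt (real CARD('n))"
  have quot: "infnorm (b x y) / (infnorm x * infnorm y) \<le> \<bar>C\<bar> * ?s * ?s" for x y
  proof (cases "x = 0 \<or> y = 0")
    case True then show ?thesis by (auto simp: infnorm_0)
  next
    case False
    have "infnorm (b x y) \<le> C * norm x * norm y" using C infnorm_le_norm order_trans by blast
    also have "\<dots> \<le> \<bar>C\<bar> * norm x * norm y" by (intro mult_right_mono) auto
    also have "\<dots> \<le> \<bar>C\<bar> * (?s * infnorm x) * (?s * infnorm y)"
      by (intro mult_mono norm_le_sqrt_infnorm) (auto simp: infnorm_pos_le)
    finally show ?thesis using False by (simp add: field_simps infnorm_pos_lt)
  qed
  have "infnorm (b x y) / (infnorm x * infnorm y) \<le> bilin_infnorm b"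
    unfolding bilin_infnorm_def
    using cSUP_upper[of "(x, y)" UNIV "\<lambda>(x, y). infnorm (b x y) / (infnorm x * infnorm y)"] quot
    by (fastforce intro!: bdd_aboveI2)
  with False show ?thesis by (simp add: field_simps infnorm_pos_lt)
qed

lemma infnorm_row_le:
  fixes A :: "real^'n^'n"
  shows "\<bar>(A *v x) $ k\<bar> \<le> (\<Sum>i\<in>UNIV. \<bar>A $ k $ i\<bar>) * infnorm x"
proof -
  have "\<bar>(A *v x) $ k\<bar> \<le> (\<Sum>i\<in>UNIV. \<bar>A $ k $ i * x $ i\<bar>)"
    unfolding matrix_vector_mult_def by simp
  also have "\<dots> \<le> (\<Sum>i\<in>UNIV. \<bar>A $ k $ i\<bar> * infnorm x)"
    by (intro sum_mono) (simp add: abs_mult mult_left_mono component_le_infnorm_cart)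
  finally show ?thesis by (simp add: sum_distrib_right)
qed

text \<open>The row sum of row \<open>k\<close> is attained at the vector of signs of the entries in that row.\<close>

lemma mat_infnorm_eq_max_row_sum:
  fixes A :: "real^'n^'n"
  shows "mat_infnorm A = Max (range (\<lambda>k. \<Sum>i\<in>UNIV. \<bar>A $ k $ i\<bar>))" (is "_ = ?M")
proof -
  have row_le: "(\<Sum>i\<in>UNIV. \<bar>A $ k $ i\<bar>) \<le> ?M" for k by simp
  have M: "?M \<ge> 0" by (rule order_trans[OF sum_abs_ge_zero row_le])
  have quot: "infnorm (A *v x) / infnorm x \<le> ?M" for x
  proof (cases "x = 0")
    case True then show ?thesis using M by (simp add: infnorm_0)
  next
    case False
    have "infnorm (A *v x) \<le> ?M * infnorm x"
      unfolding infnorm_le_iff_cart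
      using infnorm_row_le mult_right_mono[OF row_le infnorm_pos_le] order_trans by blast
    then show ?thesis using False by (simp add: field_simps infnorm_pos_lt)
  qed
  have "mat_infnorm A \<le> ?M"
    unfolding mat_infnorm_def by (rule cSUP_least) (use quot in auto)
  moreover have "(\<Sum>i\<in>UNIV. \<bar>A $ k $ i\<bar>) \<le> mat_infnorm A" for k
  proof -
    define x :: "real^'n" where "x = (\<chi> i. if A $ k $ i \<ge> 0 then 1 else - 1)"
    have "infnorm x \<le> 1" by (auto simp: infnorm_le_iff_cart x_def)
    moreover have "1 \<le> infnorm x" using component_le_infnorm_cart[of x k] by (simp add: x_def split: if_splits)
    ultimately have x: "infnorm x = 1" by simp
    have "(A *v x) $ k = (\<Sum>i\<in>UNIV. \<bar>A $ k $ i\<bar>)"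
      unfolding matrix_vector_mult_def x_def by (auto intro!: sum.cong)
    then have "(\<Sum>i\<in>UNIV. \<bar>A $ k $ i\<bar>) \<le> infnorm (A *v x) / infnorm x"
      using component_le_infnorm_cart[of "A *v x" k] x by simp
    also have "\<dots> \<le> mat_infnorm A"
      unfolding mat_infnorm_def by (rule cSUP_upper) (use quot in \<open>auto intro!: bdd_aboveI2\<close>)
    finally show ?thesis .
  qed
  then have "?M \<le> mat_infnorm A" by (subst Max_le_iff) auto
  ultimately show ?thesis by simp
qed

lemma infnorm_le_mat_infnorm: "infnorm (A *v x) \<le> mat_infnorm A * infnorm (x :: real^'n)"
proof -
  have "(\<Sum>i\<in>UNIV. \<bar>A $ k $ i\<bar>) \<le> mat_infnorm A" for k
    by (simp add: mat_infnorm_eq_max_row_sum)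
  then show ?thesis
    unfolding infnorm_le_iff_cart
    using infnorm_row_le mult_right_mono[OF _ infnorm_pos_le] order_trans by blast
qed

lemma mat_infnorm_nonneg: "0 \<le> mat_infnorm (A :: real^'n^'n)"
  unfolding mat_infnorm_eq_max_row_sum
  by (rule order_trans[OF sum_abs_ge_zero Max_ge]) auto

text \<open>For the supremum norm, \<open>\<parallel>I + hQ\<parallel>\<close> is exactly affine in \<open>h\<close> as long as no diagonal entry
  \<open>1 + h q\<^sub>k\<^sub>k\<close> changes sign, which \<open>h \<parallel>Q\<parallel> \<le> 1\<close> ensures. Hence the quotient defining the
  logarithmic norm is constant for small \<open>h\<close>, and the range of \<open>h\<close> is uniform over all
  matrices with a common norm bound; this uniformity is what the step estimate for the
  difference of two solutions relies on.\<close>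

lemma mat_infnorm_perturbation:
  fixes Q :: "real^'n^'n"
  assumes h: "0 \<le> h" "h * mat_infnorm Q \<le> 1"
  shows "mat_infnorm (mat 1 + h *\<^sub>R Q)
    = 1 + h * Max (range (\<lambda>k. Q $ k $ k + (\<Sum>i\<in>UNIV - {k}. \<bar>Q $ k $ i\<bar>)))"
proof -
  let ?\<mu> = "\<lambda>k. Q $ k $ k + (\<Sum>i\<in>UNIV - {k}. \<bar>Q $ k $ i\<bar>)"
  have "(\<Sum>i\<in>UNIV. \<bar>(mat 1 + h *\<^sub>R Q) $ k $ i\<bar>) = 1 + h * ?\<mu> k" for k
  proof -
    have "\<bar>Q $ k $ k\<bar> \<le> (\<Sum>i\<in>UNIV. \<bar>Q $ k $ i\<bar>)" by (rule member_le_sum) auto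
    also have "\<dots> \<le> mat_infnorm Q" by (simp add: mat_infnorm_eq_max_row_sum)
    finally have "h * \<bar>Q $ k $ k\<bar> \<le> 1" using h by (meson mult_left_mono order_trans)
    then have diag: "\<bar>1 + h * Q $ k $ k\<bar> = 1 + h * Q $ k $ k"
      using h(1) by (smt (verit, best) abs_mult abs_ge_minus_self abs_of_nonneg mult_minus_right)
    have "(\<Sum>i\<in>UNIV. \<bar>(mat 1 + h *\<^sub>R Q) $ k $ i\<bar>)
        = \<bar>1 + h * Q $ k $ k\<bar> + (\<Sum>i\<in>UNIV - {k}. \<bar>(mat 1 + h *\<^sub>R Q) $ k $ i\<bar>)"
      by (subst sum.remove[of _ k]) (auto simp: mat_def)
    also have "(\<Sum>i\<in>UNIV - {k}. \<bar>(mat 1 + h *\<^sub>R Q) $ k $ i\<bar>) = (\<Sum>i\<in>UNIV - {k}. h * \<bar>Q $ k $ i\<bar>)"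
      using h(1) by (intro sum.cong) (auto simp: mat_def abs_mult)
    finally show ?thesis unfolding diag by (simp add: sum_distrib_left distrib_left)
  qed
  then have "mat_infnorm (mat 1 + h *\<^sub>R Q) = Max (range (\<lambda>k. 1 + h * ?\<mu> k))"
    by (simp add: mat_infnorm_eq_max_row_sum)
  also have "\<dots> = Max ((\<lambda>c. 1 + h * c) ` range ?\<mu>)" by (simp add: image_image)
  also have "\<dots> = 1 + h * Max (range ?\<mu>)"
    using h(1) by (intro mono_Max_commute[symmetric] monoI) (auto intro: mult_left_mono)
  finally show ?thesis .
qed

lemma log_infnorm_eq_max_row:
  fixes Q :: "real^'n^'n"
  shows "log_infnorm Q = Max (range (\<lambda>k. Q $ k $ k + (\<Sum>i\<in>UNIV - {k}. \<bar>Q $ k $ i\<bar>)))"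
    (is "_ = ?m")
  unfolding log_infnorm_def
proof (rule tendsto_Lim)
  have "\<forall>\<^sub>F h in at_right 0. (mat_infnorm (mat 1 + h *\<^sub>R Q) - 1) / h = ?m"
    unfolding eventually_at_right_field
  proof (intro exI[of _ "1 / (mat_infnorm Q + 1)"] conjI allI impI)
    show "0 < 1 / (mat_infnorm Q + 1)" using mat_infnorm_nonneg[of Q] by simp
    fix h :: real assume h: "0 < h" "h < 1 / (mat_infnorm Q + 1)"
    then have "h * (mat_infnorm Q + 1) < 1" using mat_infnorm_nonneg[of Q] by (simp add: field_simps)
    then have "h * mat_infnorm Q \<le> 1" using h by (simp add: algebra_simps)
    then show "(mat_infnorm (mat 1 + h *\<^sub>R Q) - 1) / h = ?m"
      using mat_infnorm_perturbation[of h Q] h by simp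
  qed
  then show "((\<lambda>h. (mat_infnorm (mat 1 + h *\<^sub>R Q) - 1) / h) \<longlongrightarrow> ?m) (at_right 0)"
    by (rule tendsto_eventually)
qed simp

lemma infnorm_perturbation_le_log_infnorm:
  fixes Q :: "real^'n^'n"
  assumes "0 \<le> h" "h * mat_infnorm Q \<le> 1"
  shows "infnorm (u + h *\<^sub>R (Q *v u)) \<le> (1 + h * log_infnorm Q) * infnorm u"
proof -
  have "infnorm ((mat 1 + h *\<^sub>R Q) *v u) \<le> mat_infnorm (mat 1 + h *\<^sub>R Q) * infnorm u"
    by (rule infnorm_le_mat_infnorm)
  then show ?thesis
    by (simp add: mat_infnorm_perturbation[OF assms] log_infnorm_eq_max_row
        matrix_vector_mult_add_rdistrib scaleR_matrix_vector_assoc)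
qed

text \<open>The scalar mean value theorem applied to each component along the segment from \<open>y\<close> to \<open>x\<close>.\<close>

lemma infnorm_mean_value:
  fixes F :: "real^'n \<Rightarrow> real^'m"
  assumes B: "convex B" "x \<in> B" "y \<in> B"
    and F: "\<And>z. z \<in> B \<Longrightarrow> (F has_derivative F' z) (at z)"
    and bound: "\<And>z. z \<in> B \<Longrightarrow> infnorm (F' z (x - y)) \<le> c"
  shows "infnorm (F x - F y) \<le> c"
  unfolding infnorm_le_iff_cart
proof
  fix i
  define \<gamma> where "\<gamma> \<theta> = y + \<theta> *\<^sub>R (x - y)" for \<theta>
  have \<gamma>B: "\<gamma> \<theta> \<in> B" if "0 \<le> \<theta>" "\<theta> \<le> 1" for \<theta>
    using convexD_alt[OF B(1,3,2), of \<theta>] that by (simp add: \<gamma>_def algebra_simps)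
  have deriv: "((\<lambda>\<theta>. F (\<gamma> \<theta>) $ i) has_real_derivative F' (\<gamma> \<theta>) (x - y) $ i) (at \<theta>)"
    if "0 \<le> \<theta>" "\<theta> \<le> 1" for \<theta>
  proof -
    have "(\<gamma> has_derivative (\<lambda>h. h *\<^sub>R (x - y))) (at \<theta>)"
      unfolding \<gamma>_def by (auto intro!: derivative_eq_intros)
    from has_derivative_compose[OF this F[OF \<gamma>B[OF that]]]
    have "((\<lambda>\<theta>. F (\<gamma> \<theta>)) has_derivative (\<lambda>h. F' (\<gamma> \<theta>) (h *\<^sub>R (x - y)))) (at \<theta>)" .
    then have "((\<lambda>\<theta>. F (\<gamma> \<theta>)) has_derivative (\<lambda>h. h *\<^sub>R F' (\<gamma> \<theta>) (x - y))) (at \<theta>)"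
      using has_derivative_linear[OF F[OF \<gamma>B[OF that]]] by (simp add: linear_scale)
    from bounded_linear.has_derivative[OF bounded_linear_vec_nth this]
    show ?thesis by (simp add: has_field_derivative_def mult_commute_abs)
  qed
  obtain \<theta> :: real where \<theta>: "0 < \<theta>" "\<theta> < 1"
    "F (\<gamma> 1) $ i - F (\<gamma> 0) $ i = (1 - 0) * (F' (\<gamma> \<theta>) (x - y) $ i)"
    using MVT2[of 0 1 "\<lambda>\<theta>. F (\<gamma> \<theta>) $ i" "\<lambda>\<theta>. F' (\<gamma> \<theta>) (x - y) $ i"] deriv by auto
  then have "\<bar>(F x - F y) $ i\<bar> = \<bar>F' (\<gamma> \<theta>) (x - y) $ i\<bar>" by (simp add: \<gamma>_def)
  also have "\<dots> \<le> c" using bound[OF \<gamma>B[of \<theta>]] \<theta> by (auto simp: infnorm_le_iff_cart)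
  finally show "\<bar>(F x - F y) $ i\<bar> \<le> c" .
qed

lemma C2_function_has_derivative:
  assumes "C2_function f"
  shows "(f has_derivative (\<lambda>u. jacobian f (at z) *v u)) (at z)"
  using assms jacobian_works unfolding C2_function_def by blast

lemma C2_function_jacobian_has_derivative:
  assumes "C2_function f"
  shows "((\<lambda>z. jacobian f (at z) *v u) has_derivative (\<lambda>p. second_derivative f z p u)) (at z)"
proof -
  have "((\<lambda>p. jacobian f (at p)) has_derivative frechet_derivative (\<lambda>p. jacobian f (at p)) (at z)) (at z)"
    using assms frechet_derivative_works unfolding C2_function_def by blast
  moreover have "bounded_linear (\<lambda>A :: real^'a^'a. A *v u)"
    unfolding linear_conv_bounded_linear[symmetric]
    by (intro linearI) (simp_all add: matrix_vector_mult_add_rdistrib scaleR_matrix_vector_assoc)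
  ultimately show ?thesis
    unfolding second_derivative_def by (rule bounded_linear.has_derivative[rotated])
qed

lemma bilinear_second_derivative:
  assumes "C2_function f"
  shows "bilinear (second_derivative f z)"
  unfolding bilinear_def
proof (intro conjI allI)
  show "linear (\<lambda>p. second_derivative f z p u)" for u
    using C2_function_jacobian_has_derivative[OF assms] by (rule has_derivative_linear)
  show "linear (\<lambda>u. second_derivative f z p u)" for p
    unfolding second_derivative_def by simp
qed

section \<open>Growth of iterated one-step bounds\<close>

lemma mult_phi: "c \<noteq> 0 \<Longrightarrow> t * phi (c * t) = (exp (c * t) - 1) / c"
  by (auto simp: phi_def field_simps)

lemma phi_nonneg: "0 \<le> phi s"
  by (cases s "0 :: real" rule: linorder_cases) (auto simp: phi_def divide_nonpos_neg)

lemma phi_le_exp_abs: "phi s \<le> exp \<bar>s\<bar>"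
proof (cases s "0 :: real" rule: linorder_cases)
  case greater
  have "1 - s \<le> exp (- s)" using exp_ge_add_one_self[of "- s"] by simp
  then have "(1 - s) * exp s \<le> 1" by (simp add: exp_minus field_simps)
  then show ?thesis using greater by (simp add: phi_def field_simps)
next
  case less
  have "exp s - 1 \<ge> s" using exp_ge_add_one_self[of s] by linarith
  then have "phi s \<le> 1" using less by (simp add: phi_def divide_le_eq)
  also have "1 \<le> exp \<bar>s\<bar>" by simp
  finally show ?thesis .
qed (simp add: phi_def)

lemma mult_phi_mono:
  assumes "0 \<le> t" "t \<le> t'"
  shows "t * phi (c * t) \<le> t' * phi (c * t')"
proof (cases c "0 :: real" rule: linorder_cases)
  case less
  then have "exp (c * t') \<le> exp (c * t)" using assms by (simp add: mult_left_mono_neg)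
  then show ?thesis using less by (simp add: mult_phi divide_right_mono_neg)
next
  case greater
  then show ?thesis using assms by (simp add: mult_phi divide_right_mono)
qed (use assms in \<open>simp add: phi_def\<close>)

text \<open>The geometric sum is the compound interest approximation of \<open>(exp (\<Lambda> c) - 1) / \<Lambda>\<close>,
  with the value \<open>c\<close> when \<open>\<Lambda> = 0\<close>.\<close>

lemma compound_growth_tendsto:
  "(\<lambda>n. (c / real n) * (\<Sum>i<n. (1 + \<Lambda> * (c / real n)) ^ i)) \<longlonglongrightarrow> c * phi (\<Lambda> * c)"
proof (cases "\<Lambda> = 0 \<or> c = 0")
  case True
  have "\<forall>\<^sub>F n in sequentially. c * phi (\<Lambda> * c) = (c / real n) * (\<Sum>i<n. (1 + \<Lambda> * (c / real n)) ^ i)"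
    using eventually_gt_at_top[of 0] by eventually_elim (use True in \<open>auto simp: phi_def\<close>)
  then show ?thesis by (rule Lim_transform_eventually[OF tendsto_const])
next
  case False
  have "(\<lambda>n. ((1 + (\<Lambda> * c) / real n) ^ n - 1) / \<Lambda>) \<longlonglongrightarrow> (exp (\<Lambda> * c) - 1) / \<Lambda>"
    using False by (intro tendsto_intros tendsto_exp_limit_sequentially) auto
  moreover have "\<forall>\<^sub>F n in sequentially. ((1 + (\<Lambda> * c) / real n) ^ n - 1) / \<Lambda>
      = (c / real n) * (\<Sum>i<n. (1 + \<Lambda> * (c / real n)) ^ i)"
    using eventually_gt_at_top[of 0]
  proof eventually_elim
    case (elim n)
    then have "\<Lambda> * (c / real n) \<noteq> 0" using False by simp
    then have "(\<Sum>i<n. (1 + \<Lambda> * (c / real n)) ^ i) = ((1 + \<Lambda> * (c / real n)) ^ n - 1) / (\<Lambda> * (c / real n))"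
      using geometric_sum[of "1 + \<Lambda> * (c / real n)" n] by simp
    then show ?case using False elim by simp
  qed
  ultimately have "(\<lambda>n. (c / real n) * (\<Sum>i<n. (1 + \<Lambda> * (c / real n)) ^ i)) \<longlonglongrightarrow> (exp (\<Lambda> * c) - 1) / \<Lambda>"
    by (rule Lim_transform_eventually)
  then show ?thesis using False by (simp add: mult_phi)
qed

text \<open>A Gronwall lemma in discrete form. Iterating the one-step bound over \<open>n\<close> equal pieces of length
  \<open>\<eta>\<close> bounds \<open>u b\<close> by a geometric sum; the quadratic term only changes \<open>M\<close> to \<open>M + C \<eta>\<close>,
  and the sum tends to \<open>(b - a) \<phi>(\<Lambda>(b - a))\<close>. The argument covers negative \<open>\<Lambda>\<close> and functions
  \<open>u\<close> without derivative, such as the norm of the difference of two solutions. Positivity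
  of \<open>1 + \<Lambda> \<eta>\<close>, which holds once \<open>\<eta>\<close> is small, is what allows the bounds to be chained.\<close>

lemma one_step_bound_imp_growth_bound:
  fixes u :: "real \<Rightarrow> real"
  assumes ab: "a \<le> b" and u0: "u a \<le> 0" and \<delta>: "\<delta> > 0"
    and step: "\<And>p q. a \<le> p \<Longrightarrow> p \<le> q \<Longrightarrow> q \<le> b \<Longrightarrow> q - p \<le> \<delta> \<Longrightarrow>
      u q \<le> (1 + \<Lambda> * (q - p)) * u p + M * (q - p) + C * (q - p)\<^sup>2"
  shows "u b \<le> M * ((b - a) * phi (\<Lambda> * (b - a)))"
proof -
  define c where "c = b - a"
  define \<eta> where "\<eta> n = c / real n" for n :: nat
  have c: "c \<ge> 0" using ab by (simp add: c_def)
  have \<eta>0: "\<eta> \<longlonglongrightarrow> 0" unfolding \<eta>_def by (rule lim_const_over_n)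
  have "(\<lambda>n. 1 + \<Lambda> * \<eta> n) \<longlonglongrightarrow> 1 + \<Lambda> * 0"
    by (intro tendsto_intros \<eta>0)
  then have pos: "\<forall>\<^sub>F n in sequentially. 1 + \<Lambda> * \<eta> n > 0"
    by (rule order_tendstoD) simp
  have small: "\<forall>\<^sub>F n in sequentially. \<eta> n < \<delta>"
    using \<eta>0 \<delta> by (rule order_tendstoD)
  have "\<forall>\<^sub>F n in sequentially. u b \<le> (M + C * \<eta> n) * (\<eta> n * (\<Sum>i<n. (1 + \<Lambda> * \<eta> n) ^ i))"
    using pos small eventually_gt_at_top[of 0]
  proof eventually_elim
    case (elim n)
    have \<eta>n: "\<eta> n \<ge> 0" "real n * \<eta> n = c" using c elim by (auto simp: \<eta>_def)
    have "u (a + real j * \<eta> n) \<le> (M + C * \<eta> n) * (\<eta> n * (\<Sum>i<j. (1 + \<Lambda> * \<eta> n) ^ i))"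
      if "j \<le> n" for j
      using that
    proof (induction j)
      case 0
      then show ?case using u0 by simp
    next
      case (Suc j)
      let ?r = "1 + \<Lambda> * \<eta> n" and ?K = "M + C * \<eta> n"
      let ?p = "a + real j * \<eta> n" and ?q = "a + real (Suc j) * \<eta> n"
      have "real (Suc j) * \<eta> n \<le> c"
        using mult_right_mono[of "real (Suc j)" "real n" "\<eta> n"] Suc.prems \<eta>n by simp
      then have "?q \<le> b" by (simp add: c_def)
      moreover have qp: "?q - ?p = \<eta> n" by (simp add: algebra_simps)
      ultimately have "u ?q \<le> ?r * u ?p + M * \<eta> n + C * (\<eta> n)\<^sup>2"
        using step[of ?p ?q] \<eta>n(1) elim by simp
      also have "\<dots> = ?r * u ?p + ?K * \<eta> n" by (simp add: algebra_simps power2_eq_square)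
      also have "\<dots> \<le> ?r * (?K * (\<eta> n * (\<Sum>i<j. ?r ^ i))) + ?K * \<eta> n"
        using Suc elim by (intro add_right_mono mult_left_mono) auto
      also have "\<dots> = ?K * (\<eta> n * (1 + ?r * (\<Sum>i<j. ?r ^ i)))" by (simp add: algebra_simps)
      also have "1 + ?r * (\<Sum>i<j. ?r ^ i) = (\<Sum>i<Suc j. ?r ^ i)"
        by (subst sum.lessThan_Suc_shift) (simp add: sum_distrib_left)
      finally show ?case .
    qed
    from this[of n] show ?case using \<eta>n by (simp add: c_def)
  qed
  moreover have "(\<lambda>n. (M + C * \<eta> n) * (\<eta> n * (\<Sum>i<n. (1 + \<Lambda> * \<eta> n) ^ i)))
      \<longlonglongrightarrow> (M + C * 0) * (c * phi (\<Lambda> * c))"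
    by (intro tendsto_mult[OF _ compound_growth_tendsto[of c \<Lambda>, folded \<eta>_def]] tendsto_intros \<eta>0)
  ultimately have "u b \<le> (M + C * 0) * (c * phi (\<Lambda> * c))"
    by (intro tendsto_lowerbound) auto
  then show ?thesis by (simp add: c_def)
qed

text \<open>The weight in the error estimate; both halves contribute \<open>(b - a)\<^sup>2 / 8\<close>.\<close>

lemma has_integral_abs_centered:
  fixes a b :: real
  assumes "a \<le> b"
  shows "((\<lambda>s. \<bar>s - (a + (b - a) / 2)\<bar>) has_integral (b - a)\<^sup>2 / 4) {a..b}"
proof -
  define m where "m = a + (b - a) / 2"
  have m: "a \<le> m" "m \<le> b" using assms by (auto simp: m_def field_simps)
  have "((\<lambda>s. m - s) has_integral (- (m - m)\<^sup>2 / 2 - (- (m - a)\<^sup>2 / 2))) {a..m}"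
    using m(1) by (rule fundamental_theorem_of_calculus)
      (auto intro!: derivative_eq_intros simp: has_real_derivative_iff_has_vector_derivative[symmetric] field_simps)
  then have 1: "((\<lambda>s. \<bar>s - m\<bar>) has_integral (m - a)\<^sup>2 / 2) {a..m}"
    by (rule has_integral_eq_rhs[OF has_integral_eq[rotated]]) auto
  have "((\<lambda>s. s - m) has_integral ((b - m)\<^sup>2 / 2 - (m - m)\<^sup>2 / 2)) {m..b}"
    using m(2) by (rule fundamental_theorem_of_calculus)
      (auto intro!: derivative_eq_intros simp: has_real_derivative_iff_has_vector_derivative[symmetric] field_simps)
  then have 2: "((\<lambda>s. \<bar>s - m\<bar>) has_integral (b - m)\<^sup>2 / 2) {m..b}"
    by (rule has_integral_eq_rhs[OF has_integral_eq[rotated]]) auto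
  have "((\<lambda>s. \<bar>s - m\<bar>) has_integral (m - a)\<^sup>2 / 2 + (b - m)\<^sup>2 / 2) {a..b}"
    by (rule has_integral_combine[OF m 1 2])
  moreover have "(m - a)\<^sup>2 / 2 + (b - m)\<^sup>2 / 2 = (b - a)\<^sup>2 / 4"
    by (simp add: m_def field_simps power2_eq_square)
  ultimately show ?thesis unfolding m_def by (simp only:)
qed

section \<open>Comparison of two inputs over one step\<close>

lemma solution_on_has_integral:
  fixes x :: "real \<Rightarrow> real^'n"
  assumes sol: "solution_on {a..b} f v x" and pq: "a \<le> p" "p \<le> q" "q \<le> b"
  shows "((\<lambda>s. f (x s) + v s) has_integral (x q - x p)) {p..q}"
proof -
  have sub: "{p..q} \<subseteq> {a..b}" using pq by auto
  obtain N where N: "N \<in> null_sets lebesgue"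
    "\<And>s. s \<in> {a..b} - N \<Longrightarrow> (x has_vector_derivative f (x s) + v s) (at s within {a..b})"
    using sol unfolding solution_on_def eventually_ae_filter by auto
  show ?thesis
  proof (rule fundamental_theorem_of_calculus_abs_continuous)
    show "abs_continuous_on {p..q} x"
      using sol sub abs_continuous_on_subset unfolding solution_on_def by blast
    show "negligible N" using N(1) negligible_iff_null_sets by blast
    show "(x has_vector_derivative f (x s) + v s) (at s within {p..q})" if "s \<in> {p..q} - N" for s
      using N(2)[of s] that sub by (auto intro: has_vector_derivative_within_subset)
  qed (use pq in simp)
qed

text \<open>Two solutions that start at the same point, driven by inputs of sizes \<open>P\<close> and \<open>Q\<close> that share
  their mean and their first moment about the midpoint of \<open>[a, b]\<close>.\<close>

locale input_comparison =
  fixes f :: "real^'n \<Rightarrow> real^'n" and B and v w x y :: "real \<Rightarrow> real^'n"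
    and a b K L \<Lambda> H P Q :: real
  assumes ab: "a < b"
    and C2: "C2_function f"
    and convex_B: "convex B"
    and K: "\<And>z. z \<in> B \<Longrightarrow> infnorm (f z) \<le> K"
    and \<Lambda>: "\<And>z. z \<in> B \<Longrightarrow> log_infnorm (jacobian f (at z)) \<le> \<Lambda>"
    and L: "\<And>z. z \<in> B \<Longrightarrow> mat_infnorm (jacobian f (at z)) \<le> L"
    and H: "\<And>z. z \<in> B \<Longrightarrow> bilin_infnorm (second_derivative f z) \<le> H"
    and v_bound: "\<And>s. s \<in> {a..b} \<Longrightarrow> infnorm (v s) \<le> P"
    and w_bound: "\<And>s. s \<in> {a..b} \<Longrightarrow> infnorm (w s) \<le> Q"
    and same_mean: "((\<lambda>s. v s - w s) has_integral 0) {a..b}"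
    and same_moment: "((\<lambda>s. (s - (a + (b - a) / 2)) *\<^sub>R (v s - w s)) has_integral 0) {a..b}"
    and x_sol: "solution_on {a..b} f v x"
    and y_sol: "solution_on {a..b} f w y"
    and start: "x a = y a"
    and x_B: "\<And>s. s \<in> {a..b} \<Longrightarrow> x s \<in> B"
    and y_B: "\<And>s. s \<in> {a..b} \<Longrightarrow> y s \<in> B"
begin

abbreviation J where "J z \<equiv> jacobian f (at z)"

text \<open>Each constant bounds a norm at the common starting point, or at the starting time.\<close>

lemma constants_nonneg: "0 \<le> K" "0 \<le> L" "0 \<le> H" "0 \<le> P" "0 \<le> Q"
proof -
  have a: "a \<in> {a..b}" using ab by simp
  then have z: "x a \<in> B" by (rule x_B)
  show "0 \<le> K" using K[OF z] infnorm_pos_le order_trans by blast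
  show "0 \<le> L" using L[OF z] mat_infnorm_nonneg order_trans by blast
  show "0 \<le> P" using v_bound[OF a] infnorm_pos_le order_trans by blast
  show "0 \<le> Q" using w_bound[OF a] infnorm_pos_le order_trans by blast
  have "0 \<le> bilin_infnorm (second_derivative f (x a)) * infnorm (1 :: real^'n) * infnorm (1 :: real^'n)"
    using infnorm_le_bilin_infnorm[OF bilinear_second_derivative[OF C2]] infnorm_pos_le order_trans by blast
  moreover have "infnorm (1 :: real^'n) > 0" by (simp add: infnorm_pos_lt)
  ultimately show "0 \<le> H" using H[OF z] by (simp add: zero_le_mult_iff)
qed

lemma J_le: "z \<in> B \<Longrightarrow> infnorm (J z *v u) \<le> L * infnorm u"
  using infnorm_le_mat_infnorm mult_right_mono[OF L infnorm_pos_le] order_trans by blast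

lemma f_lipschitz:
  assumes "z \<in> B" "z' \<in> B"
  shows "infnorm (f z - f z') \<le> L * infnorm (z - z')"
  using infnorm_mean_value[OF convex_B assms C2_function_has_derivative[OF C2]] J_le by blast

lemma J_lipschitz:
  assumes "z \<in> B" "z' \<in> B"
  shows "infnorm (J z *v u - J z' *v u) \<le> H * infnorm (z - z') * infnorm u"
proof (rule infnorm_mean_value[OF convex_B assms C2_function_jacobian_has_derivative[OF C2]])
  fix \<xi> assume "\<xi> \<in> B"
  have "infnorm (second_derivative f \<xi> (z - z') u)
      \<le> bilin_infnorm (second_derivative f \<xi>) * infnorm (z - z') * infnorm u"
    by (rule infnorm_le_bilin_infnorm[OF bilinear_second_derivative[OF C2]])
  also have "\<dots> \<le> H * infnorm (z - z') * infnorm u"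
    using H[OF \<open>\<xi> \<in> B\<close>] by (intro mult_right_mono) (auto simp: infnorm_pos_le)
  finally show "infnorm (second_derivative f \<xi> (z - z') u) \<le> H * infnorm (z - z') * infnorm u" .
qed

text \<open>One explicit Euler step \<open>z \<mapsto> z + \<eta> f(z)\<close> has derivative \<open>I + \<eta> J\<close>, whose norm is at most
  \<open>1 + \<eta> \<Lambda>\<close>; here the logarithmic norm, rather than the norm of \<open>J\<close>, enters the growth rate.\<close>

lemma euler_step_expansion:
  assumes z: "z \<in> B" "z' \<in> B" and \<eta>: "0 \<le> \<eta>" "\<eta> * L \<le> 1"
  shows "infnorm (z - z' + \<eta> *\<^sub>R (f z - f z')) \<le> (1 + \<Lambda> * \<eta>) * infnorm (z - z')"
proof -
  have "infnorm ((z + \<eta> *\<^sub>R f z) - (z' + \<eta> *\<^sub>R f z')) \<le> (1 + \<Lambda> * \<eta>) * infnorm (z - z')"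
  proof (rule infnorm_mean_value[OF convex_B z])
    show "((\<lambda>z. z + \<eta> *\<^sub>R f z) has_derivative (\<lambda>u. u + \<eta> *\<^sub>R (J \<xi> *v u))) (at \<xi>)" for \<xi>
      by (intro derivative_intros C2_function_has_derivative[OF C2])
    fix \<xi> assume \<xi>: "\<xi> \<in> B"
    have "\<eta> * mat_infnorm (J \<xi>) \<le> 1"
      using mult_left_mono[OF L[OF \<xi>] \<eta>(1)] \<eta>(2) by linarith
    then have "infnorm ((z - z') + \<eta> *\<^sub>R (J \<xi> *v (z - z')))
        \<le> (1 + \<eta> * log_infnorm (J \<xi>)) * infnorm (z - z')"
      by (rule infnorm_perturbation_le_log_infnorm[OF \<eta>(1)])
    also have "\<dots> \<le> (1 + \<Lambda> * \<eta>) * infnorm (z - z')"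
      using mult_left_mono[OF \<Lambda>[OF \<xi>] \<eta>(1)]
      by (intro mult_right_mono infnorm_pos_le) (simp add: mult.commute)
    finally show "infnorm ((z - z') + \<eta> *\<^sub>R (J \<xi> *v (z - z'))) \<le> (1 + \<Lambda> * \<eta>) * infnorm (z - z')" .
  qed
  then show ?thesis by (simp add: algebra_simps)
qed

text \<open>Both factors of \<open>J(z) (f(z) + c)\<close> vary: the second contributes \<open>L\<^sup>2\<close>, the first
  \<open>H (K + Q)\<close>.\<close>

lemma vector_field_lipschitz:
  assumes z: "z \<in> B" "z' \<in> B" and c: "infnorm c \<le> Q"
  shows "infnorm (J z *v (f z + c) - J z' *v (f z' + c)) \<le> (L\<^sup>2 + H * (K + Q)) * infnorm (z - z')"
proof -
  let ?d = "infnorm (z - z')"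
  have "J z *v (f z + c) - J z' *v (f z' + c)
      = J z *v (f z - f z') + (J z *v (f z' + c) - J z' *v (f z' + c))"
    by (simp add: matrix_vector_right_distrib matrix_vector_mult_diff_distrib)
  then have "infnorm (J z *v (f z + c) - J z' *v (f z' + c))
      \<le> infnorm (J z *v (f z - f z')) + infnorm (J z *v (f z' + c) - J z' *v (f z' + c))"
    by (rule infnorm_le_add)
  also have "\<dots> \<le> L * (L * ?d) + H * ?d * (K + Q)"
  proof (rule add_mono)
    show "infnorm (J z *v (f z - f z')) \<le> L * (L * ?d)"
      using J_le[OF z(1)] mult_left_mono[OF f_lipschitz[OF z] constants_nonneg(2)] order_trans by blast
    have "infnorm (f z' + c) \<le> K + Q"
      using infnorm_triangle[of "f z'" c] K[OF z(2)] c by linarith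
    then have "H * ?d * infnorm (f z' + c) \<le> H * ?d * (K + Q)"
      using constants_nonneg infnorm_pos_le by (intro mult_left_mono mult_nonneg_nonneg) auto
    then show "infnorm (J z *v (f z' + c) - J z' *v (f z' + c)) \<le> H * ?d * (K + Q)"
      using J_lipschitz[OF z, of "f z' + c"] by linarith
  qed
  finally show ?thesis by (simp add: algebra_simps power2_eq_square)
qed

lemma solution_lipschitz:
  assumes pq: "a \<le> p" "p \<le> q" "q \<le> b"
  shows "infnorm (x q - x p) \<le> (K + P) * (q - p)" "infnorm (y q - y p) \<le> (K + Q) * (q - p)"
proof -
  have "infnorm (f (x s) + v s) \<le> K + P" "infnorm (f (y s) + w s) \<le> K + Q" if "s \<in> {p..q}" for s
  proof -
    have s: "s \<in> {a..b}" using that pq by auto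
    show "infnorm (f (x s) + v s) \<le> K + P"
      using infnorm_triangle[of "f (x s)" "v s"] K[OF x_B[OF s]] v_bound[OF s] by linarith
    show "infnorm (f (y s) + w s) \<le> K + Q"
      using infnorm_triangle[of "f (y s)" "w s"] K[OF y_B[OF s]] w_bound[OF s] by linarith
  qed
  then show "infnorm (x q - x p) \<le> (K + P) * (q - p)" "infnorm (y q - y p) \<le> (K + Q) * (q - p)"
    using infnorm_has_integral_le_const[OF solution_on_has_integral[OF x_sol pq] pq(2)]
      infnorm_has_integral_le_const[OF solution_on_has_integral[OF y_sol pq] pq(2)] by blast+
qed

lemma f_difference_lipschitz:
  assumes pq: "a \<le> p" "p \<le> q" "q \<le> b"
  shows "infnorm ((f (x q) - f (y q)) - (f (x p) - f (y p))) \<le> L * (2 * K + P + Q) * (q - p)"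
proof -
  have in_ab: "p \<in> {a..b}" "q \<in> {a..b}" using pq by auto
  have "infnorm (f (x q) - f (x p)) \<le> L * ((K + P) * (q - p))"
    using f_lipschitz[OF x_B[OF in_ab(2)] x_B[OF in_ab(1)]]
      mult_left_mono[OF solution_lipschitz(1)[OF pq] constants_nonneg(2)] by linarith
  moreover have "infnorm (f (y q) - f (y p)) \<le> L * ((K + Q) * (q - p))"
    using f_lipschitz[OF y_B[OF in_ab(2)] y_B[OF in_ab(1)]]
      mult_left_mono[OF solution_lipschitz(2)[OF pq] constants_nonneg(2)] by linarith
  moreover have "infnorm ((f (x q) - f (y q)) - (f (x p) - f (y p)))
      \<le> infnorm (f (x q) - f (x p)) + infnorm (f (y q) - f (y p))"
    using infnorm_triangle[of "f (x q) - f (x p)" "- (f (y q) - f (y p))"]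
    by (simp only: infnorm_neg) (simp add: algebra_simps)
  ultimately show ?thesis by (simp add: algebra_simps)
qed

text \<open>Freezing \<open>f(x) - f(y)\<close> at the left endpoint turns the evolution of \<open>x - y\<close> into an Euler step,
  plus the contribution of the inputs, plus a quadratic error because \<open>f(x) - f(y)\<close> is Lipschitz
  in time. The constants do not depend on \<open>p\<close>.\<close>

lemma difference_step:
  assumes pq: "a \<le> p" "p \<le> q" "q \<le> b" and small: "(q - p) * L \<le> 1"
  shows "infnorm (x q - y q) \<le> (1 + \<Lambda> * (q - p)) * infnorm (x p - y p) + (P + Q) * (q - p)
      + L * (2 * K + P + Q) * (q - p)\<^sup>2"
proof -
  let ?M = "L * (2 * K + P + Q)"
  define g where "g s = f (x s) - f (y s)" for s
  let ?R = "\<lambda>s. (f (x s) + v s) - (f (y s) + w s) - g p"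
  have "((\<lambda>s. g p) has_integral (q - p) *\<^sub>R g p) {p..q}"
    using has_integral_const_real[of "g p" p q] pq by simp
  then have int: "(?R has_integral ((x q - x p) - (y q - y p) - (q - p) *\<^sub>R g p)) {p..q}"
    by (intro has_integral_diff solution_on_has_integral[OF x_sol pq] solution_on_has_integral[OF y_sol pq])
  have "infnorm (?R s) \<le> P + Q + ?M * (q - p)" if s: "s \<in> {p..q}" for s
  proof -
    have s': "s \<in> {a..b}" using s pq by auto
    have "?R s = (v s + - w s) + (g s - g p)" by (simp add: g_def)
    then have "infnorm (?R s) \<le> infnorm (v s + - w s) + infnorm (g s - g p)"
      by (rule infnorm_le_add)
    then have "infnorm (?R s) \<le> infnorm (v s) + infnorm (w s) + infnorm (g s - g p)"
      using infnorm_triangle[of "v s" "- w s"] unfolding infnorm_neg by linarith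
    moreover have "infnorm (g s - g p) \<le> ?M * (s - p)"
      using f_difference_lipschitz[of p s] s pq by (simp add: g_def)
    moreover have "?M * (s - p) \<le> ?M * (q - p)"
      using constants_nonneg s by (intro mult_left_mono) auto
    ultimately show ?thesis using v_bound[OF s'] w_bound[OF s'] by linarith
  qed
  from infnorm_has_integral_le_const[OF int pq(2) this]
  have rest: "infnorm ((x q - x p) - (y q - y p) - (q - p) *\<^sub>R g p) \<le> (P + Q + ?M * (q - p)) * (q - p)" .
  have "x q - y q = (x p - y p + (q - p) *\<^sub>R g p) + ((x q - x p) - (y q - y p) - (q - p) *\<^sub>R g p)"
    by simp
  then have "infnorm (x q - y q) \<le> infnorm (x p - y p + (q - p) *\<^sub>R g p)
      + infnorm ((x q - x p) - (y q - y p) - (q - p) *\<^sub>R g p)"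
    by (rule infnorm_le_add)
  moreover have "infnorm (x p - y p + (q - p) *\<^sub>R g p) \<le> (1 + \<Lambda> * (q - p)) * infnorm (x p - y p)"
    unfolding g_def using pq small by (intro euler_step_expansion x_B y_B) auto
  ultimately show ?thesis using rest by (simp add: algebra_simps power2_eq_square)
qed

lemma difference_bound:
  assumes s: "s \<in> {a..b}"
  shows "infnorm (x s - y s) \<le> (P + Q) * ((b - a) * phi (\<Lambda> * (b - a)))"
proof -
  have "infnorm (x s - y s) \<le> (P + Q) * ((s - a) * phi (\<Lambda> * (s - a)))"
  proof (rule one_step_bound_imp_growth_bound)
    show "infnorm (x a - y a) \<le> 0" by (simp add: start infnorm_0)
    show "1 / (L + 1) > 0" using constants_nonneg by simp
    fix p q assume "a \<le> p" "p \<le> q" "q \<le> s" "q - p \<le> 1 / (L + 1)"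
    moreover from this have "(q - p) * (L + 1) \<le> 1" using constants_nonneg(2) by (simp add: field_simps)
    ultimately have "(q - p) * L \<le> 1" by (simp add: algebra_simps)
    then show "infnorm (x q - y q) \<le> (1 + \<Lambda> * (q - p)) * infnorm (x p - y p) + (P + Q) * (q - p)
        + L * (2 * K + P + Q) * (q - p)\<^sup>2"
      using \<open>a \<le> p\<close> \<open>p \<le> q\<close> \<open>q \<le> s\<close> s by (intro difference_step) auto
  qed (use s in simp)
  also have "\<dots> \<le> (P + Q) * ((b - a) * phi (\<Lambda> * (b - a)))"
    using s constants_nonneg by (intro mult_left_mono mult_phi_mono) auto
  finally show ?thesis .
qed

text \<open>Integration by parts: the fundamental theorem for \<open>F(s) = (s - m) (f(x(s)) - f(y(s)))\<close>, which is
  Lipschitz and vanishes at \<open>a\<close>. Centring the weight at the midpoint \<open>m\<close> halves the boundary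
  term and makes the moment condition on the inputs applicable.\<close>

lemma moment_integral:
  defines "m \<equiv> a + (b - a) / 2"
  shows "((\<lambda>s. (f (x s) - f (y s)) + (s - m) *\<^sub>R (J (x s) *v (f (x s) + v s) - J (y s) *v (f (y s) + w s)))
    has_integral ((b - a) / 2) *\<^sub>R (f (x b) - f (y b))) {a..b}"
proof -
  define g where "g s = f (x s) - f (y s)" for s
  define F where "F s = (s - m) *\<^sub>R g s" for s
  let ?C = "(b - a) * (L * (2 * K + P + Q)) + 2 * K"
  let ?n = "sqrt (real CARD('n))"
  have step: "infnorm (F q - F p) \<le> ?C * (q - p)" if pq: "a \<le> p" "p \<le> q" "q \<le> b" for p q
  proof -
    have p: "p \<in> {a..b}" using pq by auto
    have "F q - F p = (q - m) *\<^sub>R (g q - g p) + (q - p) *\<^sub>R g p"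
      by (simp add: F_def algebra_simps)
    then have "infnorm (F q - F p) \<le> \<bar>q - m\<bar> * infnorm (g q - g p) + (q - p) * infnorm (g p)"
      using infnorm_triangle[of "(q - m) *\<^sub>R (g q - g p)" "(q - p) *\<^sub>R g p"] pq by (simp add: infnorm_mul)
    also have "\<dots> \<le> (b - a) * (L * (2 * K + P + Q) * (q - p)) + (q - p) * (2 * K)"
    proof (intro add_mono mult_mono)
      show "\<bar>q - m\<bar> \<le> b - a" using pq by (auto simp: m_def abs_le_iff field_simps)
      show "infnorm (g q - g p) \<le> L * (2 * K + P + Q) * (q - p)"
        using f_difference_lipschitz[OF pq] by (simp add: g_def)
      show "infnorm (g p) \<le> 2 * K"
        using infnorm_triangle[of "f (x p)" "- f (y p)"] K[OF x_B[OF p]] K[OF y_B[OF p]]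
        by (simp add: g_def infnorm_neg)
    qed (use pq ab in \<open>auto simp: infnorm_pos_le\<close>)
    finally show ?thesis by (simp add: algebra_simps)
  qed
  have "(?n * ?C)-lipschitz_on {a..b} F"
  proof (rule lipschitz_on_leI)
    fix p q assume "p \<in> {a..b}" "q \<in> {a..b}" "p \<le> q"
    then have "?n * infnorm (F q - F p) \<le> ?n * (?C * (q - p))"
      by (intro mult_left_mono step) auto
    then have "norm (F q - F p) \<le> ?n * (?C * (q - p))"
      using norm_le_sqrt_infnorm order_trans by blast
    then show "dist (F p) (F q) \<le> ?n * ?C * dist p q"
      using \<open>p \<le> q\<close> by (simp add: dist_norm norm_minus_commute)
  qed (use ab constants_nonneg in simp)
  then have ac: "abs_continuous_on {a..b} F" by (rule lipschitz_imp_abs_continuous_on)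
  obtain Nx where Nx: "Nx \<in> null_sets lebesgue"
    "\<And>s. s \<in> {a..b} - Nx \<Longrightarrow> (x has_vector_derivative f (x s) + v s) (at s within {a..b})"
    using x_sol unfolding solution_on_def eventually_ae_filter by auto
  obtain Ny where Ny: "Ny \<in> null_sets lebesgue"
    "\<And>s. s \<in> {a..b} - Ny \<Longrightarrow> (y has_vector_derivative f (y s) + w s) (at s within {a..b})"
    using y_sol unfolding solution_on_def eventually_ae_filter by auto
  have chain: "((\<lambda>s. f (z s)) has_vector_derivative J (z s) *v z') (at s within {a..b})"
    if "(z has_vector_derivative z') (at s within {a..b})" for z :: "real \<Rightarrow> real^'n" and z' s
    using vector_derivative_diff_chain_within[OF that has_derivative_at_withinI[OF C2_function_has_derivative[OF C2]]]
    by (simp add: o_def)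
  have "((\<lambda>s. g s + (s - m) *\<^sub>R (J (x s) *v (f (x s) + v s) - J (y s) *v (f (y s) + w s)))
      has_integral (F b - F a)) {a..b}"
  proof (rule fundamental_theorem_of_calculus_abs_continuous[OF _ ac])
    show "negligible (Nx \<union> Ny)"
      using Nx(1) Ny(1) by (intro negligible_Un) (simp_all add: negligible_iff_null_sets)
    fix s assume s: "s \<in> {a..b} - (Nx \<union> Ny)"
    have "(g has_vector_derivative J (x s) *v (f (x s) + v s) - J (y s) *v (f (y s) + w s)) (at s within {a..b})"
      unfolding g_def using s by (intro has_vector_derivative_diff chain Nx Ny) auto
    moreover have "((\<lambda>s. s - m) has_real_derivative 1) (at s within {a..b})"
      by (auto intro!: derivative_eq_intros)
    ultimately show "(F has_vector_derivative g s + (s - m) *\<^sub>R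
        (J (x s) *v (f (x s) + v s) - J (y s) *v (f (y s) + w s))) (at s within {a..b})"
      unfolding F_def using has_vector_derivative_scaleR by (fastforce simp: add.commute)
  qed (use ab in simp)
  moreover have "F b - F a = ((b - a) / 2) *\<^sub>R (f (x b) - f (y b))"
    using start by (simp add: F_def g_def m_def field_simps)
  ultimately show ?thesis by (simp add: g_def)
qed

text \<open>With \<open>d = v - w\<close>, the expression is \<open>(J(x(s)) - J(x(m))) d\<close> plus the difference of the vector
  field \<open>z \<mapsto> J(z) (f(z) + w(s))\<close> at \<open>x(s)\<close> and \<open>y(s)\<close>. Both are of order \<open>b - a\<close>: the first
  because \<open>x\<close> is Lipschitz in time, the second because the solutions stay close.\<close>

lemma remainder_le:
  defines "m \<equiv> a + (b - a) / 2"
  assumes s: "s \<in> {a..b}"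
  shows "infnorm (J (x s) *v (f (x s) + v s) - J (y s) *v (f (y s) + w s) - J (x m) *v (v s - w s))
    \<le> (b - a) / 2 * (P + Q) * H * (K + P)
      + (b - a) * (P + Q) * (L\<^sup>2 + H * (K + Q)) * phi (\<Lambda> * (b - a))"
proof -
  have m: "m \<in> {a..b}" using ab by (auto simp: m_def field_simps)
  have vw: "infnorm (v s - w s) \<le> P + Q"
    using infnorm_triangle[of "v s" "- w s"] v_bound[OF s] w_bound[OF s] by (simp add: infnorm_neg)
  have "infnorm (x s - x m) \<le> (K + P) * \<bar>s - m\<bar>"
    using solution_lipschitz(1)[of m s] solution_lipschitz(1)[of s m] s m
    by (cases "s \<le> m") (auto simp: infnorm_sub[of "x s"])
  also have "\<dots> \<le> (K + P) * ((b - a) / 2)"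
    using s constants_nonneg by (intro mult_left_mono) (auto simp: m_def abs_le_iff field_simps)
  finally have xm: "infnorm (x s - x m) \<le> (K + P) * ((b - a) / 2)" .
  have "infnorm (J (x s) *v (v s - w s) - J (x m) *v (v s - w s))
      \<le> H * infnorm (x s - x m) * infnorm (v s - w s)"
    by (intro J_lipschitz x_B s m)
  also have "\<dots> \<le> H * ((K + P) * ((b - a) / 2)) * (P + Q)"
    using xm vw constants_nonneg ab by (intro mult_mono) (auto simp: infnorm_pos_le)
  finally have 1: "infnorm (J (x s) *v (v s - w s) - J (x m) *v (v s - w s))
      \<le> H * ((K + P) * ((b - a) / 2)) * (P + Q)" .
  have "infnorm (J (x s) *v (f (x s) + w s) - J (y s) *v (f (y s) + w s))
      \<le> (L\<^sup>2 + H * (K + Q)) * infnorm (x s - y s)"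
    by (intro vector_field_lipschitz x_B y_B s w_bound)
  also have "\<dots> \<le> (L\<^sup>2 + H * (K + Q)) * ((P + Q) * ((b - a) * phi (\<Lambda> * (b - a))))"
    using constants_nonneg by (intro mult_left_mono difference_bound s) auto
  finally have 2: "infnorm (J (x s) *v (f (x s) + w s) - J (y s) *v (f (y s) + w s))
      \<le> (L\<^sup>2 + H * (K + Q)) * ((P + Q) * ((b - a) * phi (\<Lambda> * (b - a))))" .
  have "J (x s) *v (f (x s) + v s) - J (y s) *v (f (y s) + w s) - J (x m) *v (v s - w s)
      = (J (x s) *v (v s - w s) - J (x m) *v (v s - w s))
        + (J (x s) *v (f (x s) + w s) - J (y s) *v (f (y s) + w s))"
    by (simp add: matrix_vector_right_distrib matrix_vector_mult_diff_distrib)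
  then have "infnorm (J (x s) *v (f (x s) + v s) - J (y s) *v (f (y s) + w s) - J (x m) *v (v s - w s))
      \<le> infnorm (J (x s) *v (v s - w s) - J (x m) *v (v s - w s))
        + infnorm (J (x s) *v (f (x s) + w s) - J (y s) *v (f (y s) + w s))"
    by (rule infnorm_le_add)
  with 1 2 show ?thesis by (simp add: mult_ac)
qed

text \<open>Let \<open>e = x(b) - y(b)\<close>. Since the inputs have the same mean, \<open>e\<close> is the integral of
  \<open>f(x) - f(y)\<close>, and integration by parts gives \<open>e = (h/2) (f(x(b)) - f(y(b)))\<close> minus a weighted
  integral. Subtracting \<open>J(x(m))\<close> applied to the vanishing first moment of \<open>v - w\<close> leaves the
  integral of \<open>(s - m) R(s)\<close> with \<open>R = O(h)\<close>, and \<open>\<bar>s - m\<bar>\<close> has integral \<open>h\<^sup>2 / 4\<close>. The boundary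
  term is at most \<open>(h/2) L \<parallel>e\<parallel>\<close> and accounts for the factor on the left.\<close>

theorem local_error:
  defines "h \<equiv> b - a"
  shows "(1 - (h / 2) * L) * infnorm (x b - y b)
    \<le> h ^ 3 / 8 * (P + Q) * H * (K + P) + h ^ 3 / 4 * (P + Q) * (L\<^sup>2 + H * (K + Q)) * phi (\<Lambda> * h)"
proof -
  define m where "m = a + (b - a) / 2"
  define R where "R s = J (x s) *v (f (x s) + v s) - J (y s) *v (f (y s) + w s) - J (x m) *v (v s - w s)" for s
  let ?c = "h / 2 * (P + Q) * H * (K + P) + h * (P + Q) * (L\<^sup>2 + H * (K + Q)) * phi (\<Lambda> * h)"
  have "bounded_linear (\<lambda>u. J (x m) *v u)" by simp
  from has_integral_linear[OF same_moment this]
  \<comment> \<open>The first moment stays zero when the constant matrix \<open>J (x m)\<close> is applied to it.\<close>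
  have mom: "((\<lambda>s. (s - m) *\<^sub>R (J (x m) *v (v s - w s))) has_integral 0) {a..b}"
    by (simp add: o_def m_def linear_scale[OF matrix_vector_mul_linear])
  have err: "((\<lambda>s. (f (x s) + v s) - (f (y s) + w s)) has_integral x b - y b) {a..b}"
    using has_integral_diff[OF solution_on_has_integral[OF x_sol] solution_on_has_integral[OF y_sol], of a b]
      ab start by simp
  have "((\<lambda>s. (f (x s) - f (y s)) + (s - m) *\<^sub>R
        (J (x s) *v (f (x s) + v s) - J (y s) *v (f (y s) + w s))
        - (((f (x s) + v s) - (f (y s) + w s)) - (v s - w s))
        - (s - m) *\<^sub>R (J (x m) *v (v s - w s)))
      has_integral (h / 2) *\<^sub>R (f (x b) - f (y b)) - ((x b - y b) - 0) - 0) {a..b}"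
    unfolding h_def m_def
    by (intro has_integral_diff moment_integral err[unfolded h_def m_def] same_mean mom[unfolded m_def])
  then have "((\<lambda>s. (s - m) *\<^sub>R R s) has_integral (h / 2) *\<^sub>R (f (x b) - f (y b)) - (x b - y b)) {a..b}"
    by (simp add: R_def algebra_simps)
  moreover have "((\<lambda>s. \<bar>s - m\<bar> * ?c) has_integral h\<^sup>2 / 4 * ?c) {a..b}"
    using has_integral_mult_left[OF has_integral_abs_centered[of a b]] ab by (simp add: m_def h_def)
  moreover have "infnorm ((s - m) *\<^sub>R R s) \<le> \<bar>s - m\<bar> * ?c" if "s \<in> {a..b}" for s
    using remainder_le[OF that] unfolding infnorm_mul R_def m_def h_def
    by (intro mult_left_mono) auto
  ultimately have rem: "infnorm ((h / 2) *\<^sub>R (f (x b) - f (y b)) - (x b - y b)) \<le> h\<^sup>2 / 4 * ?c"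
    by (rule infnorm_has_integral_le)
  have b: "b \<in> {a..b}" using ab by simp
  have "infnorm ((h / 2) *\<^sub>R (f (x b) - f (y b))) \<le> h / 2 * (L * infnorm (x b - y b))"
    unfolding infnorm_mul using f_lipschitz[OF x_B[OF b] y_B[OF b]] ab
    by (simp add: h_def mult_left_mono)
  moreover have "infnorm (x b - y b) \<le> infnorm ((h / 2) *\<^sub>R (f (x b) - f (y b)))
      + infnorm ((h / 2) *\<^sub>R (f (x b) - f (y b)) - (x b - y b))"
    using infnorm_triangle[of "(h / 2) *\<^sub>R (f (x b) - f (y b))" "- ((h / 2) *\<^sub>R (f (x b) - f (y b)) - (x b - y b))"]
    unfolding infnorm_neg by simp
  ultimately have "infnorm (x b - y b) \<le> h / 2 * (L * infnorm (x b - y b)) + h\<^sup>2 / 4 * ?c"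
    using rem by linarith
  moreover have "h\<^sup>2 / 4 * ?c = h ^ 3 / 8 * (P + Q) * H * (K + P)
      + h ^ 3 / 4 * (P + Q) * (L\<^sup>2 + H * (K + Q)) * phi (\<Lambda> * h)"
    by (simp add: field_simps power2_eq_square power3_eq_cube)
  moreover have "(1 - (h / 2) * L) * infnorm (x b - y b) = infnorm (x b - y b) - h / 2 * (L * infnorm (x b - y b))"
    by (simp add: left_diff_distrib)
  ultimately show ?thesis by linarith
qed

end

section \<open>The local error estimate\<close>

theorem corollary1:
  fixes V Ki :: "'n::finite \<Rightarrow> real"
    and T r K K' \<Lambda> L H :: real
  assumes V_pos: "\<And>i. V i > 0"
    and Ki_ge_1: "\<And>i. Ki i \<ge> 1"
    and Ki_bound: "\<And>i. infnorm (axis i 1 :: real^'n) \<le> Ki i"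
    and K': "K' = (\<Sum>i\<in>UNIV. V i * Ki i)"
  shows
    "\<exists>C \<delta>. \<delta> > 0 \<and>
      (\<forall>(f :: real^'n \<Rightarrow> real^'n) B N t k v w x y.
        C2_function f \<longrightarrow>
        (\<exists>a b. B = cbox a b) \<longrightarrow>
        (\<forall>z\<in>B. infnorm (f z) \<le> K \<and>
               log_infnorm (jacobian f (at z)) \<le> \<Lambda> \<and>
               mat_infnorm (jacobian f (at z)) \<le> L \<and>
               bilin_infnorm (second_derivative f z) \<le> H) \<longrightarrow>
        time_partition T N t \<longrightarrow> k < N \<longrightarrow>
        bounded_input_on {t k..t (Suc k)} V v \<longrightarrow>
        bounded_input_on {t k..t (Suc k)} (\<lambda>i. r * V i) w \<longrightarrow>
        (\<forall>i. ((\<lambda>s. v s $ i - w s $ i) has_integral 0) {t k..t (Suc k)}) \<longrightarrow>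
        (\<forall>i. ((\<lambda>s. (s - (t k + (t (Suc k) - t k) / 2)) * (v s $ i - w s $ i)) has_integral 0)
               {t k..t (Suc k)}) \<longrightarrow>
        solution_on {t k..t (Suc k)} f v x \<longrightarrow>
        solution_on {t k..t (Suc k)} f w y \<longrightarrow>
        x (t k) = y (t k) \<longrightarrow>
        (\<forall>s\<in>{t k..t (Suc k)}. x s \<in> B \<and> y s \<in> B) \<longrightarrow>
        (let h = t (Suc k) - t k;
             err = infnorm (x (t (Suc k)) - y (t (Suc k)))
         in (1 - (h / 2) * L) * err
              \<le> h ^ 3 / 8 * (1 + r) * K' * H * (K + K')
                + h ^ 3 / 4 * (1 + r) * K' * (L\<^sup>2 + H * (K + r * K')) * phi (\<Lambda> * h)
            \<and> (h < \<delta> \<longrightarrow> err \<le> C * h ^ 3)))"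
proof -
  \<comment> \<open>The coefficient of \<open>h ^ 3\<close> with \<open>phi (\<Lambda> * h)\<close> replaced by a bound valid for \<open>h \<le> 1\<close>.\<close>
  define M where "M = (1 + r) * K' * H * (K + K') / 8
      + (1 + r) * K' * (L\<^sup>2 + H * (K + r * K')) / 4 * exp \<bar>\<Lambda>\<bar>"
  \<comment> \<open>For \<open>h < \<delta>\<close> both \<open>h \<le> 1\<close> and \<open>h L \<le> 1\<close>, so the factor \<open>1 - (h/2) L\<close> is at least \<open>1/2\<close>,
    which explains the constant \<open>2 * M\<close>.\<close>
  define \<delta> where "\<delta> = 1 / (\<bar>L\<bar> + 1)"
  show ?thesis
  proof (rule exI[of _ "2 * M"], rule exI[of _ \<delta>], intro conjI allI impI)
    show "\<delta> > 0" by (simp add: \<delta>_def)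
    fix f :: "real^'n \<Rightarrow> real^'n" and B N t k v w x y
    assume C2: "C2_function f" and box: "\<exists>a b. B = cbox a b"
      and bounds: "\<forall>z\<in>B. infnorm (f z) \<le> K \<and>
               log_infnorm (jacobian f (at z)) \<le> \<Lambda> \<and>
               mat_infnorm (jacobian f (at z)) \<le> L \<and>
               bilin_infnorm (second_derivative f z) \<le> H"
      and part: "time_partition T N t" "k < N"
      and v: "bounded_input_on {t k..t (Suc k)} V v"
      and w: "bounded_input_on {t k..t (Suc k)} (\<lambda>i. r * V i) w"
      and mean: "\<forall>i. ((\<lambda>s. v s $ i - w s $ i) has_integral 0) {t k..t (Suc k)}"
      and moment: "\<forall>i. ((\<lambda>s. (s - (t k + (t (Suc k) - t k) / 2)) * (v s $ i - w s $ i)) has_integral 0)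
               {t k..t (Suc k)}"
      and sols: "solution_on {t k..t (Suc k)} f v x" "solution_on {t k..t (Suc k)} f w y"
        "x (t k) = y (t k)"
      and inB: "\<forall>s\<in>{t k..t (Suc k)}. x s \<in> B \<and> y s \<in> B"
    define h where "h = t (Suc k) - t k"
    define err where "err = infnorm (x (t (Suc k)) - y (t (Suc k)))"
    have h: "h > 0" using part by (simp add: time_partition_def h_def)
    then have tk: "t k \<in> {t k..t (Suc k)}" by (simp add: h_def)
    have nonneg: "0 \<le> V i * Ki i" for i using V_pos[of i] Ki_ge_1[of i] by simp
    have V_le: "V i \<le> K'" for i
    proof -
      have "V i \<le> V i * Ki i" using V_pos[of i] Ki_ge_1[of i] by simp
      also have "\<dots> \<le> K'"
        unfolding K' by (rule member_le_sum) (use nonneg in auto)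
      finally show ?thesis .
    qed
    \<comment> \<open>A negative \<open>r\<close> would leave no admissible value for \<open>w\<close> at the left endpoint.\<close>
    have r: "r \<ge> 0"
    proof -
      fix i :: 'n
      have "\<bar>w (t k) $ i\<bar> \<le> r * V i" using w tk unfolding bounded_input_on_def by blast
      then have "0 \<le> r * V i" by linarith
      then show ?thesis using V_pos[of i] by (simp add: zero_le_mult_iff)
    qed
    interpret input_comparison f B v w x y "t k" "t (Suc k)" K L \<Lambda> H K' "r * K'"
    proof
      show "t k < t (Suc k)" using h by (simp add: h_def)
      show "convex B" using box by auto
      show "infnorm (v s) \<le> K'" if "s \<in> {t k..t (Suc k)}" for s
        using v V_le that unfolding bounded_input_on_def infnorm_le_iff_cart by (meson order_trans)
      show "infnorm (w s) \<le> r * K'" if "s \<in> {t k..t (Suc k)}" for s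
        using w mult_left_mono[OF V_le r] that
        unfolding bounded_input_on_def infnorm_le_iff_cart by (meson order_trans)
      show "((\<lambda>s. v s - w s) has_integral 0) {t k..t (Suc k)}"
        using mean by (intro has_integral_vec_component) simp
      show "((\<lambda>s. (s - (t k + (t (Suc k) - t k) / 2)) *\<^sub>R (v s - w s)) has_integral 0) {t k..t (Suc k)}"
        using moment by (intro has_integral_vec_component) simp
    qed (use C2 bounds sols inB in auto)
    have main: "(1 - (h / 2) * L) * err
              \<le> h ^ 3 / 8 * (1 + r) * K' * H * (K + K')
                + h ^ 3 / 4 * (1 + r) * K' * (L\<^sup>2 + H * (K + r * K')) * phi (\<Lambda> * h)"
      using local_error unfolding h_def err_def by (simp add: algebra_simps)
    have "err \<le> 2 * M * h ^ 3" if "h < \<delta>"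
    proof -
      have L: "\<bar>L\<bar> = L" using constants_nonneg by simp
      have "h * (L + 1) < 1" using that constants_nonneg(2) by (simp add: \<delta>_def L field_simps)
      moreover have "0 \<le> h * L" using h constants_nonneg(2) by simp
      ultimately have hL: "h * L \<le> 1" and h1: "h \<le> 1"
        using h unfolding distrib_left by linarith+
      have "phi (\<Lambda> * h) \<le> exp \<bar>\<Lambda> * h\<bar>" by (rule phi_le_exp_abs)
      also have "\<dots> \<le> exp \<bar>\<Lambda>\<bar>" using h h1 by (simp add: abs_mult mult_left_le)
      finally have "h ^ 3 / 4 * (1 + r) * K' * (L\<^sup>2 + H * (K + r * K')) * phi (\<Lambda> * h)
          \<le> h ^ 3 / 4 * (1 + r) * K' * (L\<^sup>2 + H * (K + r * K')) * exp \<bar>\<Lambda>\<bar>"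
        using h r constants_nonneg by (intro mult_left_mono) auto
      moreover have "M * h ^ 3 = h ^ 3 / 8 * (1 + r) * K' * H * (K + K')
          + h ^ 3 / 4 * (1 + r) * K' * (L\<^sup>2 + H * (K + r * K')) * exp \<bar>\<Lambda>\<bar>"
        by (simp add: M_def field_simps)
      ultimately have "(1 - (h / 2) * L) * err \<le> M * h ^ 3"
        using main by linarith
      moreover have "1 / 2 * err \<le> (1 - (h / 2) * L) * err"
        using hL by (intro mult_right_mono) (auto simp: err_def infnorm_pos_le)
      ultimately show ?thesis by simp
    qed
    with main show "let h = t (Suc k) - t k;
             err = infnorm (x (t (Suc k)) - y (t (Suc k)))
         in (1 - (h / 2) * L) * err
              \<le> h ^ 3 / 8 * (1 + r) * K' * H * (K + K')
                + h ^ 3 / 4 * (1 + r) * K' * (L\<^sup>2 + H * (K + r * K')) * phi (\<Lambda> * h)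
            \<and> (h < \<delta> \<longrightarrow> err \<le> 2 * M * h ^ 3)"
      unfolding h_def err_def Let_def by blast
  qed
qed

end
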